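(* Let $\mathcal V$ be a variety of bounded $\lambda$-lattices $(L,\sqcup,\sqcap,{}',0,1)$ with a unary operation satisfying the identities $$x\sqcap x'\approx0\quad\text{and}\quad x\sqcup(x'\sqcap(x\sqcup y))\approx x\sqcup y .$$ Then $\mathcal V$ is congruence permutable. In particular, $\mathcal{L}s$, the class of all bounded $\lambda$-lattices $\mathbf L$ with a unary operation whose induced poset $\mathbb P(\mathbf L)$ is skew-orthomodular, is congruence permutable.
   Context: A bounded $\lambda$-lattice is an algebra $(L,\sqcup,\sqcap,0,1)$ of type $(2,2,0,0)$ satisfying the identities $x\sqcup y\approx y\sqcup x$, $x\sqcap y\approx y\sqcap x$, $x\sqcup((x\sqcup y)\sqcup z)\approx(x\sqcup y)\sqcup z$, $x\sqcap((x\sqcap y)\sqcap z)\approx(x\sqcap y)\sqcap z$, $x\sqcup(x\sqcap y)\approx x$, $x\sqcap(x\sqcup y)\approx x$, $x\sqcup0\approx x$, $x\sqcup1\approx1$. A bounded $\lambda$-lattice with a unary operation is an algebra $\mathbf L=(L,\sqcup,\sqcap,{}',0,1)$ such that $(L,\sqcup,\sqcap,0,1)$ is a bounded $\lambda$-lattice and ${}'$ is a unary operation on $L$. Its induced bounded poset with a unary operation is $\mathbb P(\mathbf L)=(L,\leq,{}',0,1)$, where $x\leq y$ if and only if $x\sqcup y=y$. Let $\mathbf P=(P,\leq,{}',0,1)$ be a bounded poset (least element $0$, greatest element $1$) with a unary operation ${}'$; $a\vee b$ and $a\wedge b$ denote $\sup(a,b)$ and $\inf(a,b)$ whenever these exist.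 $\mathbf P$ is complemented if for every $x\in P$ the elements $x\vee x'$ and $x\wedge x'$ exist with $x\vee x'=1$ and $x\wedge x'=0$. A complemented poset is orthogonal if $x\vee y$ exists for all $x,y\in P$ with $x\leq y'$. An orthogonal poset is almost skew-orthomodular if $x\vee(x'\wedge y)$ exists (i.e. $x'\wedge y$ exists and its join with $x$ exists) for all $x,y\in P$ with $x\leq y$. An almost skew-orthomodular poset is skew-orthomodular if $x\vee(x'\wedge y)=y$ for all $x,y\in P$ with $x\leq y$. A variety $\mathcal V$ is congruence permutable if $\Theta\circ\Phi=\Phi\circ\Theta$ for all $\mathbf A\in\mathcal V$ and all congruences $\Theta,\Phi$ of $\mathbf A$. *)

theory Defs
  imports "HOL-Algebra.Order"
begin

section \<open>Algebras of type (2,2,1,0,0), identities and varieties\<close>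

record 'a algebra = "'a partial_object" +
  op_join :: "'a \<Rightarrow> 'a \<Rightarrow> 'a"
  op_meet :: "'a \<Rightarrow> 'a \<Rightarrow> 'a"
  op_compl :: "'a \<Rightarrow> 'a"
  op_zero :: 'a
  op_one :: 'a

definition is_algebra :: "'a algebra \<Rightarrow> bool" where
  "is_algebra A \<longleftrightarrow>
     op_join A \<in> carrier A \<rightarrow> carrier A \<rightarrow> carrier A \<and>
     op_meet A \<in> carrier A \<rightarrow> carrier A \<rightarrow> carrier A \<and>
     op_compl A \<in> carrier A \<rightarrow> carrier A \<and>
     op_zero A \<in> carrier A \<and>
     op_one A \<in> carrier A"

datatype trm =
    Var nat
  | Join trm trm  (infixl \<open>\<^bold>\<squnion>\<close> 65)
  | Meet trm trm  (infixl \<open>\<^bold>\<sqinter>\<close> 70)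
  | Compl trm
  | Zero  (\<open>\<^bold>0\<close>)
  | One  (\<open>\<^bold>1\<close>)

primrec eval_trm :: "'a algebra \<Rightarrow> (nat \<Rightarrow> 'a) \<Rightarrow> trm \<Rightarrow> 'a" where
  "eval_trm A v (Var n) = v n"
| "eval_trm A v (s \<^bold>\<squnion> t) = op_join A (eval_trm A v s) (eval_trm A v t)"
| "eval_trm A v (s \<^bold>\<sqinter> t) = op_meet A (eval_trm A v s) (eval_trm A v t)"
| "eval_trm A v (Compl t) = op_compl A (eval_trm A v t)"
| "eval_trm A v \<^bold>0 = op_zero A"
| "eval_trm A v \<^bold>1 = op_one A"

type_synonym identity = "trm \<times> trm"

abbreviation identity_of :: "trm \<Rightarrow> trm \<Rightarrow> identity"  (infix \<open>\<approx>\<close> 50) where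
  "s \<approx> t \<equiv> (s, t)"

definition satisfies :: "'a algebra \<Rightarrow> identity \<Rightarrow> bool"  (infix \<open>\<Turnstile>\<close> 45) where
  "A \<Turnstile> e \<longleftrightarrow>
     (\<forall>v. range v \<subseteq> carrier A \<longrightarrow> eval_trm A v (fst e) = eval_trm A v (snd e))"

text \<open>
  A variety is an equational class. The set \<open>V\<close> collects those members of the variety
  whose universe is a subset of the (arbitrary) type \<open>'a\<close>.
\<close>

definition variety :: "'a algebra set \<Rightarrow> bool" where
  "variety V \<longleftrightarrow> (\<exists>E. V = {A. is_algebra A \<and> (\<forall>e\<in>E. A \<Turnstile> e)})"


section \<open>Congruence permutability\<close>

definition congruence :: "'a algebra \<Rightarrow> ('a \<times> 'a) set \<Rightarrow> bool" where
  "congruence A \<Theta> \<longleftrightarrow>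
     equiv (carrier A) \<Theta> \<and>
     (\<forall>a b c d. (a, b) \<in> \<Theta> \<longrightarrow> (c, d) \<in> \<Theta> \<longrightarrow>
        (op_join A a c, op_join A b d) \<in> \<Theta> \<and> (op_meet A a c, op_meet A b d) \<in> \<Theta>) \<and>
     (\<forall>a b. (a, b) \<in> \<Theta> \<longrightarrow> (op_compl A a, op_compl A b) \<in> \<Theta>)"

text \<open>Stated for an arbitrary class of algebras, not only for varieties.\<close>

definition congruence_permutable :: "'a algebra set \<Rightarrow> bool" where
  "congruence_permutable K \<longleftrightarrow>
     (\<forall>A\<in>K. \<forall>\<Theta> \<Phi>. congruence A \<Theta> \<longrightarrow> congruence A \<Phi> \<longrightarrow> \<Theta> O \<Phi> = \<Phi> O \<Theta>)"


section \<open>Bounded \<open>\<lambda>\<close>-lattices with a unary operation\<close>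

definition bounded_lambda_lattice_ids :: "identity set" where
  "bounded_lambda_lattice_ids =
    (let x = Var 0; y = Var 1; z = Var 2 in
     {x \<^bold>\<squnion> y \<approx> y \<^bold>\<squnion> x,
      x \<^bold>\<sqinter> y \<approx> y \<^bold>\<sqinter> x,
      x \<^bold>\<squnion> ((x \<^bold>\<squnion> y) \<^bold>\<squnion> z) \<approx> (x \<^bold>\<squnion> y) \<^bold>\<squnion> z,
      x \<^bold>\<sqinter> ((x \<^bold>\<sqinter> y) \<^bold>\<sqinter> z) \<approx> (x \<^bold>\<sqinter> y) \<^bold>\<sqinter> z,
      x \<^bold>\<squnion> (x \<^bold>\<sqinter> y) \<approx> x,
      x \<^bold>\<sqinter> (x \<^bold>\<squnion> y) \<approx> x,
      x \<^bold>\<squnion> \<^bold>0 \<approx> x,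
      x \<^bold>\<squnion> \<^bold>1 \<approx> \<^bold>1})"

definition bounded_lambda_lattice_unary :: "'a algebra \<Rightarrow> bool" where
  "bounded_lambda_lattice_unary L \<longleftrightarrow>
     is_algebra L \<and> (\<forall>e\<in>bounded_lambda_lattice_ids. L \<Turnstile> e)"


section \<open>Bounded posets with a unary operation\<close>

record 'a poset_unary = "'a gorder" +
  compl_of :: "'a \<Rightarrow> 'a"
  bot_of :: 'a
  top_of :: 'a

definition bounded_poset_unary :: "'a poset_unary \<Rightarrow> bool" where
  "bounded_poset_unary P \<longleftrightarrow>
     partial_order P \<and>
     least P (bot_of P) (carrier P) \<and>
     greatest P (top_of P) (carrier P) \<and>
     compl_of P \<in> carrier P \<rightarrow> carrier P"

text \<open>
  \<open>is_sup P a b s\<close> means that the supremum of \<open>a\<close> and \<open>b\<close> exists and equals \<open>s\<close>;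
  similarly for \<open>is_inf\<close>.
\<close>

definition is_sup :: "'a poset_unary \<Rightarrow> 'a \<Rightarrow> 'a \<Rightarrow> 'a \<Rightarrow> bool" where
  "is_sup P a b s \<longleftrightarrow> least P s (Upper P {a, b})"

definition is_inf :: "'a poset_unary \<Rightarrow> 'a \<Rightarrow> 'a \<Rightarrow> 'a \<Rightarrow> bool" where
  "is_inf P a b i \<longleftrightarrow> greatest P i (Lower P {a, b})"

definition complemented_poset :: "'a poset_unary \<Rightarrow> bool" where
  "complemented_poset P \<longleftrightarrow>
     bounded_poset_unary P \<and>
     (\<forall>x\<in>carrier P. is_sup P x (compl_of P x) (top_of P) \<and>
                    is_inf P x (compl_of P x) (bot_of P))"

definition orthogonal_poset :: "'a poset_unary \<Rightarrow> bool" where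
  "orthogonal_poset P \<longleftrightarrow>
     complemented_poset P \<and>
     (\<forall>x\<in>carrier P. \<forall>y\<in>carrier P. x \<sqsubseteq>\<^bsub>P\<^esub> compl_of P y \<longrightarrow> (\<exists>s. is_sup P x y s))"

definition almost_skew_orthomodular :: "'a poset_unary \<Rightarrow> bool" where
  "almost_skew_orthomodular P \<longleftrightarrow>
     orthogonal_poset P \<and>
     (\<forall>x\<in>carrier P. \<forall>y\<in>carrier P. x \<sqsubseteq>\<^bsub>P\<^esub> y \<longrightarrow>
        (\<exists>m s. is_inf P (compl_of P x) y m \<and> is_sup P x m s))"

definition skew_orthomodular :: "'a poset_unary \<Rightarrow> bool" where
  "skew_orthomodular P \<longleftrightarrow>
     almost_skew_orthomodular P \<and>
     (\<forall>x\<in>carrier P. \<forall>y\<in>carrier P. x \<sqsubseteq>\<^bsub>P\<^esub> y \<longrightarrow>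
        (\<exists>m. is_inf P (compl_of P x) y m \<and> is_sup P x m y))"


section \<open>The induced poset and the class \<open>\<L>s\<close>\<close>

definition induced_poset :: "'a algebra \<Rightarrow> 'a poset_unary" where
  "induced_poset L =
     \<lparr> carrier = carrier L,
       eq = (=),
       le = (\<lambda>x y. op_join L x y = y),
       compl_of = op_compl L,
       bot_of = op_zero L,
       top_of = op_one L \<rparr>"

definition Ls :: "'a algebra set" where
  "Ls = {L. bounded_lambda_lattice_unary L \<and> skew_orthomodular (induced_poset L)}"

end

theory Submission
  imports Defs
begin

text \<open>
  If \<open>a \<le> b \<le> c\<close>, \<open>a \<Theta> b\<close> and \<open>b \<Phi> c\<close>, choose \<open>m\<close> with \<open>m \<Phi> 0\<close> and \<open>c \<le> b \<squnion> m\<close>;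
  then \<open>d = (a \<squnion> m) \<sqinter> c\<close> satisfies \<open>a \<Phi> d\<close> and \<open>d \<Theta> c\<close>.
  In the variety one takes \<open>m = b' \<sqinter> c\<close>. In \<open>\<L>s\<close> the operations need not return existing
  suprema and infima, so the second identity may fail there; but the infimum
  \<open>m\<close> of \<open>b'\<close> and \<open>c\<close> still works, because \<open>m = m \<sqinter> c \<Phi> m \<sqinter> b = 0\<close>.

  If \<open>a \<Theta> b \<Phi> c\<close> is arbitrary, put \<open>p = a \<squnion> b\<close>, \<open>q = c \<squnion> b\<close> and \<open>u = p \<squnion> q\<close>. The chains
  \<open>a \<Theta> p \<Phi> u\<close> and \<open>c \<Phi> q \<Theta> u\<close> yield \<open>d, e \<le> u\<close> with \<open>a \<Phi> d \<Theta> u\<close> and \<open>c \<Theta> e \<Phi> u\<close>,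
  so that \<open>a \<Phi> d \<sqinter> e \<Theta> c\<close>.
\<close>

locale lambda_lattice_unary =
  fixes L :: "'a algebra"
  assumes lattice: "bounded_lambda_lattice_unary L"
begin

abbreviation join (infixl \<open>\<squnion>\<close> 65) where "x \<squnion> y \<equiv> op_join L x y"
abbreviation meet (infixl \<open>\<sqinter>\<close> 70) where "x \<sqinter> y \<equiv> op_meet L x y"
abbreviation zero (\<open>\<zero>\<close>) where "\<zero> \<equiv> op_zero L"

section \<open>Arithmetic and order of a bounded \<lambda>-lattice\<close>

lemma closed [simp]:
  "\<lbrakk>x \<in> carrier L; y \<in> carrier L\<rbrakk> \<Longrightarrow> x \<squnion> y \<in> carrier L"
  "\<lbrakk>x \<in> carrier L; y \<in> carrier L\<rbrakk> \<Longrightarrow> x \<sqinter> y \<in> carrier L"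
  "x \<in> carrier L \<Longrightarrow> op_compl L x \<in> carrier L"
  "\<zero> \<in> carrier L"
  using lattice by (auto simp: bounded_lambda_lattice_unary_def is_algebra_def Pi_iff)

lemma identities:
  assumes "x \<in> carrier L" "y \<in> carrier L" "z \<in> carrier L"
  shows "x \<squnion> y = y \<squnion> x \<and> x \<sqinter> y = y \<sqinter> x \<and> x \<squnion> ((x \<squnion> y) \<squnion> z) = (x \<squnion> y) \<squnion> z \<and>
    x \<squnion> (x \<sqinter> y) = x \<and> x \<sqinter> (x \<squnion> y) = x \<and> x \<squnion> \<zero> = x"
proof -
  \<comment> \<open>The identities mention only \<open>Var 0\<close>, \<open>Var 1\<close> and
    \<open>Var 2\<close>; all other indices get \<open>z\<close>, which keeps the range inside the
    carrier.\<close>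
  define v where "v = (\<lambda>n::nat. if n = 0 then x else if n = 1 then y else z)"
  have v: "v 0 = x" "v 1 = y" "v 2 = z" and "range v \<subseteq> carrier L"
    using assms by (auto simp: v_def)
  then have ids: "\<forall>e\<in>bounded_lambda_lattice_ids. eval_trm L v (fst e) = eval_trm L v (snd e)"
    using lattice by (simp add: bounded_lambda_lattice_unary_def satisfies_def)
  show ?thesis
    using ids[unfolded bounded_lambda_lattice_ids_def Let_def ball_simps eval_trm.simps
      fst_conv snd_conv v]
    by blast
qed

lemma join_comm: "\<lbrakk>x \<in> carrier L; y \<in> carrier L\<rbrakk> \<Longrightarrow> x \<squnion> y = y \<squnion> x"
  using identities by blast

lemma meet_comm: "\<lbrakk>x \<in> carrier L; y \<in> carrier L\<rbrakk> \<Longrightarrow> x \<sqinter> y = y \<sqinter> x"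
  using identities by blast

lemma join_weak_assoc:
  "\<lbrakk>x \<in> carrier L; y \<in> carrier L; z \<in> carrier L\<rbrakk> \<Longrightarrow> x \<squnion> ((x \<squnion> y) \<squnion> z) = (x \<squnion> y) \<squnion> z"
  using identities by blast

lemma join_absorb: "\<lbrakk>x \<in> carrier L; y \<in> carrier L\<rbrakk> \<Longrightarrow> x \<squnion> (x \<sqinter> y) = x"
  using identities by blast

lemma meet_absorb: "\<lbrakk>x \<in> carrier L; y \<in> carrier L\<rbrakk> \<Longrightarrow> x \<sqinter> (x \<squnion> y) = x"
  using identities by blast

lemma join_zero: "x \<in> carrier L \<Longrightarrow> x \<squnion> \<zero> = x"
  using identities by blast

text \<open>Absorption alone gives x = x \<squnion> (x \<sqinter> (x \<squnion> x)) = x \<squnion>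
  x.\<close>

lemma join_idem: "x \<in> carrier L \<Longrightarrow> x \<squnion> x = x"
  by (metis closed(1) join_absorb meet_absorb)

definition below (infix \<open>\<preceq>\<close> 50) where "x \<preceq> y \<longleftrightarrow> x \<squnion> y = y"

text \<open>Once x \<squnion> y = y and y \<squnion> z = z are inserted, weak associativity x
  \<squnion> ((x \<squnion> y) \<squnion> z) = (x \<squnion> y) \<squnion> z reads x \<squnion> z =
  z.\<close>

lemma below_trans:
  "\<lbrakk>x \<preceq> y; y \<preceq> z; x \<in> carrier L; y \<in> carrier L; z \<in> carrier L\<rbrakk> \<Longrightarrow> x \<preceq> z"
  unfolding below_def by (metis join_weak_assoc)

lemma below_join1: "\<lbrakk>x \<in> carrier L; y \<in> carrier L\<rbrakk> \<Longrightarrow> x \<preceq> x \<squnion> y"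
  unfolding below_def by (metis closed(1) join_absorb join_comm meet_absorb meet_comm)

lemma below_join2: "\<lbrakk>x \<in> carrier L; y \<in> carrier L\<rbrakk> \<Longrightarrow> y \<preceq> x \<squnion> y"
  using below_join1 join_comm by metis

lemma meet_below1: "\<lbrakk>x \<in> carrier L; y \<in> carrier L\<rbrakk> \<Longrightarrow> x \<sqinter> y \<preceq> x"
  unfolding below_def by (metis closed(2) join_absorb join_comm)

lemma meet_below2: "\<lbrakk>x \<in> carrier L; y \<in> carrier L\<rbrakk> \<Longrightarrow> x \<sqinter> y \<preceq> y"
  using meet_below1 meet_comm by metis

lemma meet_eq: "\<lbrakk>x \<preceq> y; x \<in> carrier L; y \<in> carrier L\<rbrakk> \<Longrightarrow> x \<sqinter> y = x"
  unfolding below_def by (metis meet_absorb)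

section \<open>Congruences, and permutability from differences\<close>

lemma cong_carrier:
  "congruence L \<Theta> \<Longrightarrow> (x, y) \<in> \<Theta> \<Longrightarrow> x \<in> carrier L \<and> y \<in> carrier L"
  unfolding congruence_def equiv_def by blast

lemma cong_refl: "congruence L \<Theta> \<Longrightarrow> x \<in> carrier L \<Longrightarrow> (x, x) \<in> \<Theta>"
  unfolding congruence_def equiv_def by (blast dest: refl_onD)

lemma cong_sym: "congruence L \<Theta> \<Longrightarrow> (x, y) \<in> \<Theta> \<Longrightarrow> (y, x) \<in> \<Theta>"
  unfolding congruence_def equiv_def by (blast dest: symD)

lemma cong_trans: "congruence L \<Theta> \<Longrightarrow> (x, y) \<in> \<Theta> \<Longrightarrow> (y, z) \<in> \<Theta> \<Longrightarrow> (x, z) \<in> \<Theta>"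
  unfolding congruence_def equiv_def by (blast dest: transD)

lemma cong_join:
  "congruence L \<Theta> \<Longrightarrow> (a, b) \<in> \<Theta> \<Longrightarrow> (c, d) \<in> \<Theta> \<Longrightarrow> (a \<squnion> c, b \<squnion> d) \<in> \<Theta>"
  unfolding congruence_def by blast

lemma cong_meet:
  "congruence L \<Theta> \<Longrightarrow> (a, b) \<in> \<Theta> \<Longrightarrow> (c, d) \<in> \<Theta> \<Longrightarrow> (a \<sqinter> c, b \<sqinter> d) \<in> \<Theta>"
  unfolding congruence_def by blast

lemma cong_compl:
  "congruence L \<Theta> \<Longrightarrow> (a, b) \<in> \<Theta> \<Longrightarrow> (op_compl L a, op_compl L b) \<in> \<Theta>"
  unfolding congruence_def by blast

text \<open>Common interface to both classes: \<open>m\<close> acts as a difference of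
  \<open>c\<close> and \<open>b\<close>, chosen independently of \<Phi>. Only an inequality is
  asked, because \<squnion> yields some upper bound, which may overshoot \<open>c\<close>.\<close>

definition has_differences :: bool where
  "has_differences \<longleftrightarrow>
     (\<forall>b\<in>carrier L. \<forall>c\<in>carrier L. b \<preceq> c \<longrightarrow>
       (\<exists>m\<in>carrier L. c \<preceq> b \<squnion> m \<and>
          (\<forall>\<Phi>. congruence L \<Phi> \<longrightarrow> (b, c) \<in> \<Phi> \<longrightarrow> (m, \<zero>) \<in> \<Phi>)))"

text \<open>The bound on \<open>d\<close> is recorded because later d \<sqinter> u must reduce to
  \<open>d\<close>.\<close>

lemma permute_chain:
  assumes "has_differences" and \<Theta>: "congruence L \<Theta>" and \<Phi>: "congruence L \<Phi>"
    and ab: "(a, b) \<in> \<Theta>" "a \<preceq> b" and bc: "(b, c) \<in> \<Phi>" "b \<preceq> c"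
  obtains d where "(a, d) \<in> \<Phi>" "(d, c) \<in> \<Theta>" "d \<preceq> c"
proof -
  have carr: "a \<in> carrier L" "b \<in> carrier L" "c \<in> carrier L"
    using cong_carrier \<Theta> \<Phi> ab bc by auto
  obtain m where m: "m \<in> carrier L" "c \<preceq> b \<squnion> m" "(m, \<zero>) \<in> \<Phi>"
    using assms(1) carr bc \<Phi> unfolding has_differences_def by blast
  have ac: "a \<preceq> c"
    using below_trans ab bc carr by blast
  \<comment> \<open>Modulo \<Phi>, \<open>m\<close> vanishes, so (a \<squnion> m) \<sqinter> c
    collapses to a \<sqinter> c = a.\<close>
  have "(a \<squnion> m, a \<squnion> \<zero>) \<in> \<Phi>"
    using \<Phi> carr m by (intro cong_join cong_refl)
  then have "((a \<squnion> m) \<sqinter> c, a \<sqinter> c) \<in> \<Phi>"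
    using cong_meet[OF \<Phi> _ cong_refl[OF \<Phi>]] carr by (simp add: join_zero)
  then have "(a, (a \<squnion> m) \<sqinter> c) \<in> \<Phi>"
    using meet_eq[OF ac] carr cong_sym[OF \<Phi>] by simp
  \<comment> \<open>Modulo \<Theta>, \<open>a\<close> may be replaced by \<open>b\<close>; the meet
    with \<open>c\<close> then cuts off any overshoot of b \<squnion> m.\<close>
  moreover have "((a \<squnion> m) \<sqinter> c, (b \<squnion> m) \<sqinter> c) \<in> \<Theta>"
    using \<Theta> carr m ab by (intro cong_meet cong_join cong_refl)
  then have "((a \<squnion> m) \<sqinter> c, c) \<in> \<Theta>"
    using meet_eq[OF m(2)] meet_comm[of "b \<squnion> m" c] carr m(1) by simp
  moreover have "(a \<squnion> m) \<sqinter> c \<preceq> c"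
    using carr m by (simp add: meet_below2)
  ultimately show thesis by (rule that)
qed

lemma permute_subset:
  assumes diff: "has_differences" and \<Theta>: "congruence L \<Theta>" and \<Phi>: "congruence L \<Phi>"
  shows "\<Theta> O \<Phi> \<subseteq> \<Phi> O \<Theta>"
proof clarify
  fix a b c
  assume ab: "(a, b) \<in> \<Theta>" and bc: "(b, c) \<in> \<Phi>"
  have carr: "a \<in> carrier L" "b \<in> carrier L" "c \<in> carrier L"
    using cong_carrier \<Theta> \<Phi> ab bc by auto
  \<comment> \<open>Without associativity, \<open>(a \<squnion> b) \<squnion> c\<close> and \<open>a \<squnion> (b \<squnion> c)\<close> may differ; \<open>u\<close> is an upper
    bound treating \<open>a\<close> and \<open>c\<close> symmetrically.\<close>
  define p q u where "p = a \<squnion> b" and "q = c \<squnion> b" and "u = p \<squnion> q"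
  have carr': "p \<in> carrier L" "q \<in> carrier L" "u \<in> carrier L"
    using carr by (auto simp: p_def q_def u_def)
  have below: "a \<preceq> p" "b \<preceq> p" "c \<preceq> q" "b \<preceq> q" "p \<preceq> u" "q \<preceq> u"
    using carr carr' below_join1 below_join2 by (auto simp: p_def q_def u_def)
  have pb: "(p, b) \<in> \<Theta>"
    using cong_join[OF \<Theta> ab cong_refl[OF \<Theta>]] join_idem carr unfolding p_def by metis
  have qb: "(q, b) \<in> \<Phi>"
    using cong_join[OF \<Phi> cong_sym[OF \<Phi> bc] cong_refl[OF \<Phi>]] join_idem carr
    unfolding q_def by metis
  have "(a, p) \<in> \<Theta>" "(c, q) \<in> \<Phi>"
    using cong_trans[OF \<Theta> ab cong_sym[OF \<Theta> pb]]
      cong_trans[OF \<Phi> cong_sym[OF \<Phi> bc] cong_sym[OF \<Phi> qb]] by auto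
  \<comment> \<open>Since b \<Phi> q and b \<Theta> p, joining with \<open>p\<close> and
    \<open>q\<close> respectively leads to \<open>u\<close>, while \<open>b\<close> is absorbed by
    both.\<close>
  moreover have "(p \<squnion> b, u) \<in> \<Phi>" "(b \<squnion> q, u) \<in> \<Theta>"
    using cong_join[OF \<Phi> cong_refl[OF \<Phi>] cong_sym[OF \<Phi> qb]]
      cong_join[OF \<Theta> cong_sym[OF \<Theta> pb] cong_refl[OF \<Theta>]] carr'
    by (auto simp: u_def)
  then have "(p, u) \<in> \<Phi>" "(q, u) \<in> \<Theta>"
    using below(2,4) join_comm[of p b] carr carr' by (auto simp: below_def)
  ultimately have au: "(a, p) \<in> \<Theta>" "(p, u) \<in> \<Phi>" and cu: "(c, q) \<in> \<Phi>" "(q, u) \<in> \<Theta>"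
    by auto
  obtain d
    where d: "(a, d) \<in> \<Phi>" "(d, u) \<in> \<Theta>" "d \<preceq> u"
    using permute_chain[OF diff \<Theta> \<Phi> au(1) below(1) au(2) below(5)] .
  obtain e where e: "(c, e) \<in> \<Theta>" "(e, u) \<in> \<Phi>" "e \<preceq> u"
    using permute_chain[OF diff \<Phi> \<Theta> cu(1) below(3) cu(2) below(6)] .
  have carr'': "d \<in> carrier L" "e \<in> carrier L"
    using cong_carrier \<Theta> \<Phi> d e by auto
  \<comment> \<open>As \<open>d\<close> and \<open>e\<close> lie below \<open>u\<close>, the outer
    meets d \<sqinter> u and u \<sqinter> e are \<open>d\<close> and \<open>e\<close>
    themselves.\<close>
  have "(d \<sqinter> u, d \<sqinter> e) \<in> \<Phi>" "(d \<sqinter> e, u \<sqinter> e) \<in> \<Theta>"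
    using cong_meet[OF \<Phi> cong_refl[OF \<Phi>] cong_sym[OF \<Phi> e(2)]]
      cong_meet[OF \<Theta> d(2) cong_refl[OF \<Theta>]] carr'' by auto
  then have "(d, d \<sqinter> e) \<in> \<Phi>" "(d \<sqinter> e, e) \<in> \<Theta>"
    using meet_eq d(3) e(3) meet_comm[of u e] carr' carr'' by auto
  then have "(a, d \<sqinter> e) \<in> \<Phi>" "(d \<sqinter> e, c) \<in> \<Theta>"
    using cong_trans[OF \<Phi> d(1)] cong_trans[OF \<Theta> _ cong_sym[OF \<Theta> e(1)]] by auto
  then show "(a, c) \<in> \<Phi> O \<Theta>" by blast
qed

section \<open>Existence of differences in the two classes\<close>

lemma has_differences_if_identities:
  assumes "L \<Turnstile> Var 0 \<^bold>\<sqinter> Compl (Var 0) \<approx> \<^bold>0"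
    and "L \<Turnstile> Var 0 \<^bold>\<squnion> (Compl (Var 0) \<^bold>\<sqinter> (Var 0 \<^bold>\<squnion> Var 1)) \<approx> Var 0 \<^bold>\<squnion> Var 1"
  shows "has_differences"
  unfolding has_differences_def
proof (intro ballI impI)
  fix b c
  assume carr: "b \<in> carrier L" "c \<in> carrier L" and "b \<preceq> c"
  \<comment> \<open>With \<open>Var 1\<close> read as \<open>c\<close>, b \<squnion> c = c turns the
    second identity into b \<squnion> ?m = c.\<close>
  let ?v = "\<lambda>n::nat. if n = 0 then b else c" and ?m = "op_compl L b \<sqinter> c"
  have "range ?v \<subseteq> carrier L"
    using carr by auto
  then have "eval_trm L ?v (Var 0 \<^bold>\<sqinter> Compl (Var 0)) = eval_trm L ?v \<^bold>0"
    and "eval_trm L ?v (Var 0 \<^bold>\<squnion> (Compl (Var 0) \<^bold>\<sqinter> (Var 0 \<^bold>\<squnion> Var 1)))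
      = eval_trm L ?v (Var 0 \<^bold>\<squnion> Var 1)"
    using assms unfolding satisfies_def by (metis fst_conv snd_conv)+
  then have "b \<sqinter> op_compl L b = \<zero>" and "b \<squnion> ?m = c"
    using \<open>b \<preceq> c\<close> by (simp_all add: below_def)
  then have "op_compl L b \<sqinter> b = \<zero>" and "c \<preceq> b \<squnion> ?m"
    using carr meet_comm[of b "op_compl L b"] join_idem by (auto simp: below_def)
  \<comment> \<open>Replacing \<open>c\<close> by its \<Phi>-equivalent \<open>b\<close> turns
    \<open>?m\<close> into b' \<sqinter> b = 0.\<close>
  moreover have "(?m, op_compl L b \<sqinter> b) \<in> \<Phi>"
    if "congruence L \<Phi>" "(b, c) \<in> \<Phi>" for \<Phi>
    using that carr by (intro cong_meet cong_compl cong_refl cong_sym[of _ b c]) auto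
  ultimately show "\<exists>m\<in>carrier L. c \<preceq> b \<squnion> m \<and>
      (\<forall>\<Phi>. congruence L \<Phi> \<longrightarrow> (b, c) \<in> \<Phi> \<longrightarrow> (m, \<zero>) \<in> \<Phi>)"
    using carr by (intro bexI[of _ ?m]) auto
qed

lemma is_sup_induced_iff:
  assumes "a \<in> carrier L" "b \<in> carrier L"
  shows "is_sup (induced_poset L) a b s \<longleftrightarrow>
    s \<in> carrier L \<and> a \<preceq> s \<and> b \<preceq> s \<and> (\<forall>z\<in>carrier L. a \<preceq> z \<and> b \<preceq> z \<longrightarrow> s \<preceq> z)"
  using assms unfolding is_sup_def least_def Upper_def induced_poset_def below_def by auto

lemma is_inf_induced_iff:
  assumes "a \<in> carrier L" "b \<in> carrier L"
  shows "is_inf (induced_poset L) a b i \<longleftrightarrow>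
    i \<in> carrier L \<and> i \<preceq> a \<and> i \<preceq> b \<and> (\<forall>z\<in>carrier L. z \<preceq> a \<and> z \<preceq> b \<longrightarrow> z \<preceq> i)"
  using assms unfolding is_inf_def greatest_def Lower_def induced_poset_def below_def by auto

lemma has_differences_if_skew_orthomodular:
  assumes som: "skew_orthomodular (induced_poset L)"
  shows "has_differences"
  unfolding has_differences_def
proof (intro ballI impI)
  fix b c
  assume carr: "b \<in> carrier L" "c \<in> carrier L" and bc: "b \<preceq> c"
  have compl: "is_inf (induced_poset L) b (op_compl L b) \<zero>"
    using som carr
    unfolding skew_orthomodular_def almost_skew_orthomodular_def orthogonal_poset_def
      complemented_poset_def
    by (simp add: induced_poset_def)
  have "\<exists>m. is_inf (induced_poset L) (op_compl L b) c m \<and> is_sup (induced_poset L) b m c"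
    using som carr bc unfolding skew_orthomodular_def
    by (simp add: induced_poset_def below_def)
  then obtain m where inf: "is_inf (induced_poset L) (op_compl L b) c m"
    and sup: "is_sup (induced_poset L) b m c"
    by blast
  have m: "m \<in> carrier L" "m \<preceq> op_compl L b" "m \<preceq> c"
    using inf carr by (simp_all add: is_inf_induced_iff)
  \<comment> \<open>b \<squnion> m is an upper bound of \<open>b\<close> and \<open>m\<close>, hence
    lies above their supremum \<open>c\<close>.\<close>
  have "c \<preceq> b \<squnion> m"
    using sup carr m by (simp add: is_sup_induced_iff below_join1 below_join2)
  \<comment> \<open>m \<sqinter> b is a common lower bound of \<open>b\<close> and b', whose infimum
    is 0; no value of b \<sqinter> b' enters.\<close>
  moreover have "m \<sqinter> b = \<zero>"
  proof -
    have "m \<sqinter> b \<preceq> op_compl L b"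
      using below_trans[OF meet_below1] m carr by simp
    then have "m \<sqinter> b \<preceq> \<zero>"
      using compl carr m by (simp add: is_inf_induced_iff meet_below2)
    then show ?thesis
      using join_zero carr m unfolding below_def by (metis closed(2))
  qed
  moreover have "(m \<sqinter> c, m \<sqinter> b) \<in> \<Phi>" if "congruence L \<Phi>" "(b, c) \<in> \<Phi>" for \<Phi>
    using that m by (intro cong_meet cong_refl cong_sym[of _ b c])
  ultimately show "\<exists>m\<in>carrier L. c \<preceq> b \<squnion> m \<and>
      (\<forall>\<Phi>. congruence L \<Phi> \<longrightarrow> (b, c) \<in> \<Phi> \<longrightarrow> (m, \<zero>) \<in> \<Phi>)"
    using carr m by (intro bexI[of _ m]) (auto simp: meet_eq)
qed

end

lemma congruence_permutableI:
  assumes "\<And>L. L \<in> K \<Longrightarrow> bounded_lambda_lattice_unary L"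
    and "\<And>L. L \<in> K \<Longrightarrow> lambda_lattice_unary.has_differences L"
  shows "congruence_permutable K"
  unfolding congruence_permutable_def
proof (intro ballI allI impI)
  fix L \<Theta> \<Phi>
  assume L: "L \<in> K" and cong: "congruence L \<Theta>" "congruence L \<Phi>"
  interpret lambda_lattice_unary L
    using assms(1)[OF L] by unfold_locales
  \<comment> \<open>The inclusion is available for every pair of congruences, so exchanging \<Theta>
    and \<Phi> gives the reverse one.\<close>
  show "\<Theta> O \<Phi> = \<Phi> O \<Theta>"
    using permute_subset[OF assms(2)[OF L]] cong by blast
qed

theorem theorem8:
  fixes V :: "'a algebra set"
  shows "(variety V \<longrightarrow>
          (\<forall>L\<in>V. bounded_lambda_lattice_unary L \<and>
            L \<Turnstile> Var 0 \<^bold>\<sqinter> Compl (Var 0) \<approx> \<^bold>0 \<and>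
            L \<Turnstile> Var 0 \<^bold>\<squnion> (Compl (Var 0) \<^bold>\<sqinter> (Var 0 \<^bold>\<squnion> Var 1)) \<approx> Var 0 \<^bold>\<squnion> Var 1) \<longrightarrow>
          congruence_permutable V) \<and>
         congruence_permutable (Ls :: 'a algebra set)"
proof (intro conjI impI)
  assume "\<forall>L\<in>V. bounded_lambda_lattice_unary L \<and>
    L \<Turnstile> Var 0 \<^bold>\<sqinter> Compl (Var 0) \<approx> \<^bold>0 \<and>
    L \<Turnstile> Var 0 \<^bold>\<squnion> (Compl (Var 0) \<^bold>\<sqinter> (Var 0 \<^bold>\<squnion> Var 1)) \<approx> Var 0 \<^bold>\<squnion> Var 1"
  then show "congruence_permutable V"
    using lambda_lattice_unary.has_differences_if_identities
    by (intro congruence_permutableI) (auto simp: lambda_lattice_unary_def)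
next
  show "congruence_permutable (Ls :: 'a algebra set)"
    using lambda_lattice_unary.has_differences_if_skew_orthomodular
    by (intro congruence_permutableI) (auto simp: lambda_lattice_unary_def Ls_def)
qed

end
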